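(* Let $\alpha$ be a composition of $n$ and $\sigma\in\mathfrak{S}_{\ell(\alpha)}$. For each $1\le i\le n-1$, the operator $\pi_i$ maps $\mathrm{SPCT}^\sigma(\alpha)$ into $\mathrm{SPCT}^\sigma(\alpha)\cup\{0\}$, and, extended linearly to the $\mathbb{C}$-span of $\mathrm{SPCT}^\sigma(\alpha)$, the operators $\pi_1,\dots,\pi_{n-1}$ satisfy the relations of the $0$-Hecke algebra $H_n(0)$: $\pi_i^2=\pi_i$ for $1\le i\le n-1$, $\pi_i\pi_{i+1}\pi_i=\pi_{i+1}\pi_i\pi_{i+1}$ for $1\le i\le n-2$, and $\pi_i\pi_j=\pi_j\pi_i$ for $|i-j|\ge 2$. Thus they define an action of $H_n(0)$ (with $T_i$ acting as $\pi_i$) on the span of $\mathrm{SPCT}^\sigma(\alpha)$.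
   Context: A composition $\alpha=(\alpha_1,\dots,\alpha_k)$ of $n$ is a sequence of positive integers with sum $n$; $\ell(\alpha)=k$. Its composition diagram is the left-justified array whose $i$-th row from the top has $\alpha_i$ cells. The standardization $\mathrm{stan}(w)$ of a word $w_1\cdots w_m$ of positive integers is the unique $\pi\in\mathfrak{S}_m$ with $\pi(i)>\pi(j)$ iff $w_i>w_j$ for $i<j$. For $\sigma\in\mathfrak{S}_{\ell(\alpha)}$, a permuted composition tableau of shape $\alpha$ and type $\sigma$ is a filling of the diagram of $\alpha$ with positive integers such that: the first-column entries are distinct and the standardization of the first column read top to bottom is $\sigma$; rows weakly decrease left to right; and (triple condition) whenever $i<r$ and cells $(i,j),(i,j+1),(r,j+1)$ lie in the diagram with entries $a,b,c$, $a\ge c$ implies $b>c$. $\mathrm{SPCT}^\sigma(\alpha)$ denotes those such fillings whose entries are distinct and at most $n$ (so the entries are exactly $1,\dots,n$). For $\tau\in\mathrm{SPCT}^\sigma(\alpha)$ and $1\le i\le n-1$: $i$ is a descent of $\tau$ ($i\in\mathrm{des}(\tau)$) if $i+1$ lies in a column weakly to the right of the column of $i$. The entries $i,i+1$ are attacking if either they lie in the same column, or $i+1$ lies in the column immediately to the right of the column of $i$ and in a row strictly below the row of $i$. Let $s_i(\tau)$ be the filling obtained by swapping the positions of $i$ and $i+1$. Define $\pi_i(\tau)=\tau$ if $i\notin\mathrm{des}(\tau)$; $\pi_i(\tau)=0$ if $i\in\mathrm{des}(\tau)$ and $i,i+1$ are attacking; $\pi_i(\tau)=s_i(\tau)$ if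 $i\in\mathrm{des}(\tau)$ and $i,i+1$ are not attacking. The $0$-Hecke algebra $H_n(0)$ is the $\mathbb{C}$-algebra generated by $T_1,\dots,T_{n-1}$ subject to $T_i^2=T_i$, $T_iT_{i+1}T_i=T_{i+1}T_iT_{i+1}$, and $T_iT_j=T_jT_i$ for $|i-j|\ge2$. *)

theory Defs
  imports
    Complex_Main
    "HOL-Library.Poly_Mapping"
    "HOL-Library.FuncSet"
    "HOL-Combinatorics.Permutations"
    "HOL-Algebra.QuotRing"
begin

section \<open>Permuted composition tableaux\<close>

definition composition :: "nat \<Rightarrow> nat list \<Rightarrow> bool" where
  "composition n \<alpha> \<longleftrightarrow> (\<forall>a\<in>set \<alpha>. 0 < a) \<and> sum_list \<alpha> = n"

text \<open>Cells are pairs (row, column), both counted from 1, with row 1 on top.\<close>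

definition diagram :: "nat list \<Rightarrow> (nat \<times> nat) set" where
  "diagram \<alpha> = {(i, j). 1 \<le> i \<and> i \<le> length \<alpha> \<and> 1 \<le> j \<and> j \<le> \<alpha> ! (i - 1)}"

type_synonym filling = "nat \<times> nat \<Rightarrow> nat"

text \<open>The elements of the symmetric group on m letters are the functions
  \<^term>\<open>\<pi>\<close> with \<^prop>\<open>\<pi> permutes {1..m}\<close>; they fix everything outside \<^term>\<open>{1..m}\<close>.\<close>

definition stan :: "nat list \<Rightarrow> nat \<Rightarrow> nat" where
  "stan w = (THE \<pi>. \<pi> permutes {1..length w} \<and>
     (\<forall>i j. 1 \<le> i \<and> i < j \<and> j \<le> length w \<longrightarrow> (\<pi> i > \<pi> j \<longleftrightarrow> w ! (i - 1) > w ! (j - 1))))"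

definition first_column :: "nat list \<Rightarrow> filling \<Rightarrow> nat list" where
  "first_column \<alpha> \<tau> = map (\<lambda>i. \<tau> (i, 1)) [1..<Suc (length \<alpha>)]"

text \<open>Fillings are extensional (\<^const>\<open>undefined\<close> off the diagram), so that equality of functions is
  equality of fillings.\<close>

definition PCT :: "(nat \<Rightarrow> nat) \<Rightarrow> nat list \<Rightarrow> filling set" where
  "PCT \<sigma> \<alpha> = {\<tau> \<in> diagram \<alpha> \<rightarrow>\<^sub>E {1..}.
     distinct (first_column \<alpha> \<tau>) \<and> stan (first_column \<alpha> \<tau>) = \<sigma> \<and>
     (\<forall>i j. (i, j) \<in> diagram \<alpha> \<and> (i, j + 1) \<in> diagram \<alpha> \<longrightarrow> \<tau> (i, j) \<ge> \<tau> (i, j + 1)) \<and>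
     (\<forall>i r j. i < r \<and> (i, j) \<in> diagram \<alpha> \<and> (i, j + 1) \<in> diagram \<alpha> \<and> (r, j + 1) \<in> diagram \<alpha> \<longrightarrow>
        \<tau> (i, j) \<ge> \<tau> (r, j + 1) \<longrightarrow> \<tau> (i, j + 1) > \<tau> (r, j + 1))}"

definition SPCT :: "(nat \<Rightarrow> nat) \<Rightarrow> nat list \<Rightarrow> filling set" where
  "SPCT \<sigma> \<alpha> = {\<tau> \<in> PCT \<sigma> \<alpha>. inj_on \<tau> (diagram \<alpha>) \<and> (\<forall>c\<in>diagram \<alpha>. \<tau> c \<le> sum_list \<alpha>)}"


section \<open>Descents and the operators on tableaux\<close>

definition row_of :: "nat list \<Rightarrow> filling \<Rightarrow> nat \<Rightarrow> nat" where
  "row_of \<alpha> \<tau> i = fst (inv_into (diagram \<alpha>) \<tau> i)"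

definition col_of :: "nat list \<Rightarrow> filling \<Rightarrow> nat \<Rightarrow> nat" where
  "col_of \<alpha> \<tau> i = snd (inv_into (diagram \<alpha>) \<tau> i)"

definition des :: "nat list \<Rightarrow> filling \<Rightarrow> nat set" where
  "des \<alpha> \<tau> = {i. 1 \<le> i \<and> i + 1 \<le> sum_list \<alpha> \<and> col_of \<alpha> \<tau> (i + 1) \<ge> col_of \<alpha> \<tau> i}"

definition attacking :: "nat list \<Rightarrow> filling \<Rightarrow> nat \<Rightarrow> bool" where
  "attacking \<alpha> \<tau> i \<longleftrightarrow>
     col_of \<alpha> \<tau> (i + 1) = col_of \<alpha> \<tau> i \<or>
     (col_of \<alpha> \<tau> (i + 1) = col_of \<alpha> \<tau> i + 1 \<and> row_of \<alpha> \<tau> (i + 1) > row_of \<alpha> \<tau> i)"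

definition swap_entries :: "nat list \<Rightarrow> nat \<Rightarrow> filling \<Rightarrow> filling" where
  "swap_entries \<alpha> i \<tau> = compose (diagram \<alpha>) (Transposition.transpose i (i + 1)) \<tau>"

text \<open>Formal complex linear combinations of elements of \<^typ>\<open>'a\<close> are elements of
  \<^typ>\<open>'a \<Rightarrow>\<^sub>0 complex\<close>; the basis vector belonging to \<^term>\<open>x\<close> is \<^term>\<open>Poly_Mapping.single x 1\<close>.\<close>

abbreviation basis_vec :: "'a \<Rightarrow> ('a \<Rightarrow>\<^sub>0 complex)" where
  "basis_vec x \<equiv> Poly_Mapping.single x 1"

definition cscale :: "complex \<Rightarrow> ('a \<Rightarrow>\<^sub>0 complex) \<Rightarrow> ('a \<Rightarrow>\<^sub>0 complex)" where
  "cscale c v = Poly_Mapping.map ((*) c) v"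

lemma lookup_cscale [simp]: "Poly_Mapping.lookup (cscale c v) x = c * Poly_Mapping.lookup v x"
  by (simp add: cscale_def Poly_Mapping.map.rep_eq when_def)

global_interpretation formal: vector_space cscale
  by unfold_locales (auto intro!: poly_mapping_eqI simp: lookup_add algebra_simps)

definition linear_extension :: "('a \<Rightarrow> ('b \<Rightarrow>\<^sub>0 complex)) \<Rightarrow> ('a \<Rightarrow>\<^sub>0 complex) \<Rightarrow> ('b \<Rightarrow>\<^sub>0 complex)" where
  "linear_extension f v = (\<Sum>x\<in>Poly_Mapping.keys v. cscale (Poly_Mapping.lookup v x) (f x))"

definition SPCT_span :: "(nat \<Rightarrow> nat) \<Rightarrow> nat list \<Rightarrow> (filling \<Rightarrow>\<^sub>0 complex) set" where
  "SPCT_span \<sigma> \<alpha> = formal.span (basis_vec ` SPCT \<sigma> \<alpha>)"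

definition tableau_op :: "nat list \<Rightarrow> nat \<Rightarrow> filling \<Rightarrow> (filling \<Rightarrow>\<^sub>0 complex)" where
  "tableau_op \<alpha> i \<tau> =
     (if i \<notin> des \<alpha> \<tau> then basis_vec \<tau>
      else if attacking \<alpha> \<tau> i then 0
      else basis_vec (swap_entries \<alpha> i \<tau>))"

definition pi_op :: "nat list \<Rightarrow> nat \<Rightarrow> (filling \<Rightarrow>\<^sub>0 complex) \<Rightarrow> (filling \<Rightarrow>\<^sub>0 complex)" where
  "pi_op \<alpha> i = linear_extension (tableau_op \<alpha> i)"


section \<open>The 0-Hecke algebra by generators and relations\<close>

text \<open>Written additively, because the convolution product of \<^typ>\<open>'a \<Rightarrow>\<^sub>0 'b\<close> requires
  an additive monoid on the left.\<close>

datatype 'a free_monoid = Free_Monoid (letters: "'a list")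

instantiation free_monoid :: (type) monoid_add
begin

definition "0 = Free_Monoid []"

definition "u + v = Free_Monoid (letters u @ letters v)"

instance
  by standard (auto simp: zero_free_monoid_def plus_free_monoid_def)

end

type_synonym free_elem = "nat free_monoid \<Rightarrow>\<^sub>0 complex"

text \<open>The free associative complex algebra on generators indexed by \<^term>\<open>{1..<n}\<close>.\<close>

definition free_algebra :: "nat \<Rightarrow> free_elem ring" where
  "free_algebra n =
     \<lparr>carrier = {p. \<forall>u\<in>Poly_Mapping.keys p. set (letters u) \<subseteq> {1..<n}},
      mult = (*), one = 1, zero = 0, add = (+)\<rparr>"

definition free_gen :: "nat \<Rightarrow> free_elem" where
  "free_gen i = Poly_Mapping.single (Free_Monoid [i]) 1"

definition hecke_relations :: "nat \<Rightarrow> free_elem set" where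
  "hecke_relations n =
     {free_gen i * free_gen i - free_gen i | i. i \<in> {1..<n}} \<union>
     {free_gen i * free_gen (i + 1) * free_gen i - free_gen (i + 1) * free_gen i * free_gen (i + 1)
        | i. i \<in> {1..<n} \<and> i + 1 \<in> {1..<n}} \<union>
     {free_gen i * free_gen j - free_gen j * free_gen i
        | i j. i \<in> {1..<n} \<and> j \<in> {1..<n} \<and> \<bar>int i - int j\<bar> \<ge> 2}"

definition hecke_ideal :: "nat \<Rightarrow> free_elem set" where
  "hecke_ideal n = Idl\<^bsub>free_algebra n\<^esub> (hecke_relations n)"

definition hecke_algebra :: "nat \<Rightarrow> free_elem set ring" where
  "hecke_algebra n = free_algebra n Quot hecke_ideal n"

definition hecke_class :: "nat \<Rightarrow> free_elem \<Rightarrow> free_elem set" where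
  "hecke_class n p = hecke_ideal n +>\<^bsub>free_algebra n\<^esub> p"

definition hecke_gen :: "nat \<Rightarrow> nat \<Rightarrow> free_elem set" where
  "hecke_gen n i = hecke_class n (free_gen i)"

text \<open>Multiplication by the scalar \<^term>\<open>c\<close> is multiplication by the image of \<^term>\<open>c\<close>, that is, of
  \<^term>\<open>c\<close> times the empty word.\<close>

definition hecke_scale :: "nat \<Rightarrow> complex \<Rightarrow> free_elem set \<Rightarrow> free_elem set" where
  "hecke_scale n c h = hecke_class n (Poly_Mapping.single 0 c) \<otimes>\<^bsub>hecke_algebra n\<^esub> h"

lemma ring_free_algebra: "ring (free_algebra n)"
proof (rule ringI)
  show "abelian_group (free_algebra n)"
  proof (rule abelian_groupI)
    fix x assume "x \<in> carrier (free_algebra n)"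
    then show "\<exists>y\<in>carrier (free_algebra n). y \<oplus>\<^bsub>free_algebra n\<^esub> x = \<zero>\<^bsub>free_algebra n\<^esub>"
      by (intro bexI[of _ "- x"]) (auto simp: free_algebra_def in_keys_iff)
  qed (use keys_add in \<open>fastforce simp: free_algebra_def add_ac\<close>)+
  show "Group.monoid (free_algebra n)"
  proof (rule monoidI)
    fix x y assume "x \<in> carrier (free_algebra n)" "y \<in> carrier (free_algebra n)"
    then show "x \<otimes>\<^bsub>free_algebra n\<^esub> y \<in> carrier (free_algebra n)"
      using keys_mult[of x y] by (fastforce simp: free_algebra_def plus_free_monoid_def)
  qed (auto simp: free_algebra_def mult.assoc zero_free_monoid_def)
qed (auto simp: free_algebra_def distrib_left distrib_right)

text \<open>A complex linear action of the 0-Hecke algebra on a space \<^term>\<open>V\<close> of formal linear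
  combinations, i.e. a unital homomorphism of complex algebras into the linear endomorphisms
  of \<^term>\<open>V\<close>.\<close>

locale hecke_action =
  fixes n :: nat
    and V :: "('a \<Rightarrow>\<^sub>0 complex) set"
    and act :: "free_elem set \<Rightarrow> ('a \<Rightarrow>\<^sub>0 complex) \<Rightarrow> ('a \<Rightarrow>\<^sub>0 complex)"
  assumes subspace: "formal.subspace V"
    and closed: "\<lbrakk>h \<in> carrier (hecke_algebra n); v \<in> V\<rbrakk> \<Longrightarrow> act h v \<in> V"
    and add_right: "\<lbrakk>h \<in> carrier (hecke_algebra n); v \<in> V; w \<in> V\<rbrakk> \<Longrightarrow> act h (v + w) = act h v + act h w"
    and scale_right: "\<lbrakk>h \<in> carrier (hecke_algebra n); v \<in> V\<rbrakk> \<Longrightarrow> act h (cscale c v) = cscale c (act h v)"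
    and add_left: "\<lbrakk>h \<in> carrier (hecke_algebra n); h' \<in> carrier (hecke_algebra n); v \<in> V\<rbrakk> \<Longrightarrow>
      act (h \<oplus>\<^bsub>hecke_algebra n\<^esub> h') v = act h v + act h' v"
    and scale_left: "\<lbrakk>h \<in> carrier (hecke_algebra n); v \<in> V\<rbrakk> \<Longrightarrow>
      act (hecke_scale n c h) v = cscale c (act h v)"
    and mult: "\<lbrakk>h \<in> carrier (hecke_algebra n); h' \<in> carrier (hecke_algebra n); v \<in> V\<rbrakk> \<Longrightarrow>
      act (h \<otimes>\<^bsub>hecke_algebra n\<^esub> h') v = act h (act h' v)"
    and one: "v \<in> V \<Longrightarrow> act \<one>\<^bsub>hecke_algebra n\<^esub> v = v"

end

theory Submission
  imports Defs
begin

text \<open>Stability under the operators is where the tableau conditions enter. The relations hold for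
  every bijective filling, by tracing the positions of
  \<^term>\<open>i\<close>, \<^term>\<open>i + 1\<close>, \<^term>\<open>i + 2\<close> through the comparisons of their columns. The free algebra acts
  through words in the operators, and the relations hold on the span of the tableaux, so the
  annihilator of this span is an ideal containing the defining ideal of the 0-Hecke algebra.\<close>

section \<open>Linear extension\<close>

text \<open>Coefficients vanish off the support, so any finite superset of \<open>keys v\<close> may
  index the sum. Combinations with different supports can then be compared over one set.\<close>

lemma linear_extension_eq_sum:
  assumes "finite A" "Poly_Mapping.keys v \<subseteq> A"
  shows "linear_extension f v = (\<Sum>x\<in>A. cscale (Poly_Mapping.lookup v x) (f x))"
  unfolding linear_extension_def
  by (rule sum.mono_neutral_left) (use assms in \<open>auto simp: in_keys_iff\<close>)

lemma linear_extension_add: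
  "linear_extension f (v + w) = linear_extension f v + linear_extension f w"
proof -
  let ?A = "Poly_Mapping.keys v \<union> Poly_Mapping.keys w"
  have *: "finite ?A" by simp
  show ?thesis
    using Poly_Mapping.keys_add[of v w]
    by (simp add: linear_extension_eq_sum[OF *] lookup_add formal.scale_left_distrib sum.distrib)
qed

lemma linear_extension_scale:
  "linear_extension f (cscale c v) = cscale c (linear_extension f v)"
proof -
  have "Poly_Mapping.keys (cscale c v) \<subseteq> Poly_Mapping.keys v" by (auto simp: in_keys_iff)
  then show ?thesis
    by (simp add: linear_extension_eq_sum[of "Poly_Mapping.keys v"] formal.scale_sum_right)
qed

lemma linear_extension_zero [simp]: "linear_extension f 0 = 0"
  by (simp add: linear_extension_def)

lemma linear_extension_diff:
  "linear_extension f (v - w) = linear_extension f v - linear_extension f w"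
  using linear_extension_add[of f "v - w" w] by (simp add: algebra_simps)

lemma linear_extension_basis_vec [simp]: "linear_extension f (basis_vec x) = f x"
  by (simp add: linear_extension_def)

text \<open>With \<open>A = UNIV\<close> this brings every formal combination within reach of
  \<open>eq_on_span_basis_vec\<close>.\<close>

lemma in_span_basis_vec:
  assumes "Poly_Mapping.keys v \<subseteq> A"
  shows "v \<in> formal.span (basis_vec ` A)"
proof -
  have "v = (\<Sum>x\<in>Poly_Mapping.keys v. cscale (Poly_Mapping.lookup v x) (basis_vec x))"
    by (rule poly_mapping_eqI)
      (auto simp: lookup_sum lookup_single when_def in_keys_iff
        if_distrib sum.delta cong: if_cong)
  also have "\<dots> \<in> formal.span (basis_vec ` A)"
    using assms by (intro formal.span_sum formal.span_scale formal.span_base) auto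
  finally show ?thesis .
qed

text \<open>Additive and homogeneous maps are written out, since \<^const>\<open>Vector_Spaces.linear\<close>
  would have to be instantiated at two copies of \<^const>\<open>cscale\<close>.\<close>

lemma eq_on_span_basis_vec:
  fixes F G :: "('a \<Rightarrow>\<^sub>0 complex) \<Rightarrow> ('b \<Rightarrow>\<^sub>0 complex)"
  assumes "v \<in> formal.span (basis_vec ` A)"
    and "\<And>v w. F (v + w) = F v + F w" "\<And>c v. F (cscale c v) = cscale c (F v)"
    and "\<And>v w. G (v + w) = G v + G w" "\<And>c v. G (cscale c v) = cscale c (G v)"
    and "\<And>x. x \<in> A \<Longrightarrow> F (basis_vec x) = G (basis_vec x)"
  shows "F v = G v"
  using assms(1)
proof (induction rule: formal.span_induct_alt)
  case base
  \<comment> \<open>Homogeneity at the scalar 0 forces \<open>F 0 = 0\<close> and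
    \<open>G 0 = 0\<close>.\<close>
  show ?case using assms(3)[of 0 0] assms(5)[of 0 0] by simp
next
  case (step c x y)
  then show ?case using assms by auto
qed

section \<open>Fillings with entries 1, \<dots>, n\<close>

text \<open>In contrast to the tableaux in general, this class is stable under each swap of
  \<open>i\<close> and \<open>i + 1\<close> with both entries in range, so positions can be followed
  through successive swaps without returning to the triple condition.\<close>

definition standard_filling :: "nat list \<Rightarrow> filling \<Rightarrow> bool" where
  "standard_filling \<alpha> \<tau> \<longleftrightarrow>
     \<tau> \<in> extensional (diagram \<alpha>) \<and> bij_betw \<tau> (diagram \<alpha>) {1..sum_list \<alpha>}"

lemma finite_diagram [simp]: "finite (diagram \<alpha>)"
  and card_diagram: "card (diagram \<alpha>) = sum_list \<alpha>"
proof -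
  have eq: "diagram \<alpha> = (SIGMA i:{1..length \<alpha>}. {1..\<alpha> ! (i - 1)})"
    by (auto simp: diagram_def)
  show "finite (diagram \<alpha>)" unfolding eq by auto
  have "card (diagram \<alpha>) = (\<Sum>i=1..length \<alpha>. \<alpha> ! (i - 1))"
    unfolding eq by simp
  also have "\<dots> = sum_list \<alpha>"
    unfolding sum_list_sum_nth
    \<comment> \<open>Rows are numbered from 1 and list positions from 0, hence the shift.\<close>
    by (rule sum.reindex_bij_witness[of _ Suc "\<lambda>i. i - 1"]) auto
  finally show "card (diagram \<alpha>) = sum_list \<alpha>" .
qed

text \<open>There are as many cells as admissible values, so injectivity gives surjectivity by
  counting.\<close>

lemma standard_filling_if_SPCT:
  assumes "\<tau> \<in> SPCT \<sigma> \<alpha>"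
  shows "standard_filling \<alpha> \<tau>"
proof -
  have ext: "\<tau> \<in> diagram \<alpha> \<rightarrow>\<^sub>E {1..}" and inj: "inj_on \<tau> (diagram \<alpha>)"
    and le: "\<forall>c\<in>diagram \<alpha>. \<tau> c \<le> sum_list \<alpha>"
    using assms by (auto simp: SPCT_def PCT_def)
  have "\<tau> ` diagram \<alpha> = {1..sum_list \<alpha>}"
  proof (rule card_subset_eq)
    show "\<tau> ` diagram \<alpha> \<subseteq> {1..sum_list \<alpha>}" using ext le by fastforce
    show "card (\<tau> ` diagram \<alpha>) = card {1..sum_list \<alpha>}"
      using inj by (simp add: card_image card_diagram)
  qed simp
  with ext inj show ?thesis
    by (auto simp: standard_filling_def bij_betw_def PiE_def)
qed

section \<open>Positions of entries after a swap\<close>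

lemma swap_entries_apply:
  "c \<in> diagram \<alpha> \<Longrightarrow> swap_entries \<alpha> i \<tau> c = Transposition.transpose i (i + 1) (\<tau> c)"
  by (simp add: swap_entries_def compose_def)

lemma standard_filling_swap_entries:
  assumes "standard_filling \<alpha> \<tau>" "i \<in> {1..<sum_list \<alpha>}"
  shows "standard_filling \<alpha> (swap_entries \<alpha> i \<tau>)"
proof -
  have "bij_betw (Transposition.transpose i (i + 1)) {1..sum_list \<alpha>} {1..sum_list \<alpha>}"
    using assms(2) by (intro permutes_imp_bij permutes_swap_id) auto
  with assms(1) show ?thesis
    by (auto simp: standard_filling_def swap_entries_def intro: bij_betw_compose)
qed

lemma inv_into_swap_entries:
  assumes "standard_filling \<alpha> \<tau>" "i \<in> {1..<sum_list \<alpha>}" "k \<in> {1..sum_list \<alpha>}"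
  shows "inv_into (diagram \<alpha>) (swap_entries \<alpha> i \<tau>) k =
    inv_into (diagram \<alpha>) \<tau> (Transposition.transpose i (i + 1) k)"
proof (rule inv_into_f_eq)
  show "inj_on (swap_entries \<alpha> i \<tau>) (diagram \<alpha>)"
    using standard_filling_swap_entries[OF assms(1,2)]
    by (simp add: standard_filling_def bij_betw_def)
  have "Transposition.transpose i (i + 1) k \<in> \<tau> ` diagram \<alpha>"
    using assms by (auto simp: standard_filling_def bij_betw_def Transposition.transpose_def)
  then show "inv_into (diagram \<alpha>) \<tau> (Transposition.transpose i (i + 1) k) \<in> diagram \<alpha>"
    and "swap_entries \<alpha> i \<tau> (inv_into (diagram \<alpha>) \<tau> (Transposition.transpose i (i + 1) k)) = k"
    by (auto simp: inv_into_into swap_entries_apply f_inv_into_f)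
qed

text \<open>Written with a conditional instead of the transposition, so that nested swaps are
  evaluated at \<open>i\<close>, \<open>i + 1\<close>, \<open>i + 2\<close> by comparing indices
  alone.\<close>

lemma col_of_swap_entries:
  assumes "standard_filling \<alpha> \<tau>" "i \<in> {1..<sum_list \<alpha>}" "k \<in> {1..sum_list \<alpha>}"
  shows "col_of \<alpha> (swap_entries \<alpha> i \<tau>) k =
    col_of \<alpha> \<tau> (if k = i then i + 1 else if k = i + 1 then i else k)"
  using inv_into_swap_entries[OF assms] by (auto simp: col_of_def Transposition.transpose_def)

lemma row_of_swap_entries:
  assumes "standard_filling \<alpha> \<tau>" "i \<in> {1..<sum_list \<alpha>}" "k \<in> {1..sum_list \<alpha>}"
  shows "row_of \<alpha> (swap_entries \<alpha> i \<tau>) k =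
    row_of \<alpha> \<tau> (if k = i then i + 1 else if k = i + 1 then i else k)"
  using inv_into_swap_entries[OF assms] by (auto simp: row_of_def Transposition.transpose_def)

lemma swap_entries_braid:
  "swap_entries \<alpha> i (swap_entries \<alpha> (Suc i) (swap_entries \<alpha> i \<tau>)) =
   swap_entries \<alpha> (Suc i) (swap_entries \<alpha> i (swap_entries \<alpha> (Suc i) \<tau>))"
  by (auto simp: swap_entries_def compose_def fun_eq_iff Transposition.transpose_def)

lemma swap_entries_commute:
  "\<bar>int i - int j\<bar> \<ge> 2 \<Longrightarrow>
   swap_entries \<alpha> i (swap_entries \<alpha> j \<tau>) = swap_entries \<alpha> j (swap_entries \<alpha> i \<tau>)"
  by (auto simp: swap_entries_def compose_def fun_eq_iff Transposition.transpose_def)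

section \<open>The operators on tableaux\<close>

text \<open>No value lies strictly between \<open>i\<close> and \<open>i + 1\<close>, so exchanging
  them can reverse only the comparison of these two with each other.\<close>

lemma transpose_adjacent_less_iff:
  fixes x y :: nat
  assumes "{x, y} \<noteq> {i, i + 1}"
  shows "Transposition.transpose i (i + 1) x < Transposition.transpose i (i + 1) y \<longleftrightarrow> x < y"
  using assms by (auto simp: Transposition.transpose_def insert_commute)

text \<open>\<open>stan\<close> refers to a word only through its length and its inversions; words
  agreeing in both yield the same predicate under \<open>THE\<close>.\<close>

lemma stan_cong:
  assumes "length w = length w'"
    and "\<And>i j. \<lbrakk>i < j; j < length w\<rbrakk> \<Longrightarrow> w ! j < w ! i \<longleftrightarrow> w' ! j < w' ! i"
  shows "stan w = stan w'"
proof -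
  have "w ! (j - 1) < w ! (i - 1) \<longleftrightarrow> w' ! (j - 1) < w' ! (i - 1)"
    if "1 \<le> i \<and> i < j \<and> j \<le> length w'" for i j
    using that assms by auto
  then have "(\<lambda>\<pi>. \<pi> permutes {1..length w} \<and>
     (\<forall>i j. 1 \<le> i \<and> i < j \<and> j \<le> length w \<longrightarrow> (\<pi> i > \<pi> j \<longleftrightarrow> w ! (i - 1) > w ! (j - 1)))) =
    (\<lambda>\<pi>. \<pi> permutes {1..length w'} \<and>
     (\<forall>i j. 1 \<le> i \<and> i < j \<and> j \<le> length w' \<longrightarrow> (\<pi> i > \<pi> j \<longleftrightarrow> w' ! (i - 1) > w' ! (j - 1))))"
    using assms(1) by (auto simp: fun_eq_iff)
  then show ?thesis unfolding stan_def by (rule arg_cong)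
qed

text \<open>The conditions defining a tableau only compare entries of one column, of adjacent cells of a
  row, and of pairs of cells that would make \<^term>\<open>i\<close> and \<^term>\<open>i + 1\<close> attacking. None of these
  pairs can consist of \<^term>\<open>i\<close> and \<^term>\<open>i + 1\<close>, so all comparisons survive the swap.\<close>

lemma swap_entries_in_SPCT:
  assumes "composition n \<alpha>" "\<tau> \<in> SPCT \<sigma> \<alpha>" "i \<in> des \<alpha> \<tau>" "\<not> attacking \<alpha> \<tau> i"
  shows "swap_entries \<alpha> i \<tau> \<in> SPCT \<sigma> \<alpha>"
proof -
  let ?s = "swap_entries \<alpha> i \<tau>" and ?t = "Transposition.transpose i (i + 1)"
  have std: "standard_filling \<alpha> \<tau>" by (rule standard_filling_if_SPCT[OF assms(2)])
  have i: "i \<in> {1..<sum_list \<alpha>}" using assms(3) by (auto simp: des_def)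
  have std': "standard_filling \<alpha> ?s" by (rule standard_filling_swap_entries[OF std i])
  have inj: "inj_on \<tau> (diagram \<alpha>)" using std by (simp add: standard_filling_def bij_betw_def)
  have col: "col_of \<alpha> \<tau> (\<tau> c) = snd c" and row: "row_of \<alpha> \<tau> (\<tau> c) = fst c"
    if "c \<in> diagram \<alpha>" for c
    using that inj by (auto simp: col_of_def row_of_def)
  \<comment> \<open>The positions excluded for the cell \<open>c\<close> of \<open>i\<close> and the
    cell \<open>d\<close> of \<open>i + 1\<close>: being a non-attacking descent puts
    \<open>d\<close> strictly right of \<open>c\<close>, and not below it when the columns are
    adjacent.\<close>
  have pair: "False" if "c \<in> diagram \<alpha>" "d \<in> diagram \<alpha>" "\<tau> c = i" "\<tau> d = i + 1"
    "snd d \<le> snd c \<or> snd d = snd c + 1 \<and> fst c < fst d" for c d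
    using that assms(3,4) col[of c] col[of d] row[of c] row[of d]
    by (auto simp: des_def attacking_def)
  have less: "?s c < ?s d \<longleftrightarrow> \<tau> c < \<tau> d"
    if "c \<in> diagram \<alpha>" "d \<in> diagram \<alpha>" "{\<tau> c, \<tau> d} \<noteq> {i, i + 1}" for c d
    using that transpose_adjacent_less_iff[of "\<tau> c" "\<tau> d" i] by (simp add: swap_entries_apply)
  have same_col: "?s c < ?s d \<longleftrightarrow> \<tau> c < \<tau> d"
    if "c \<in> diagram \<alpha>" "d \<in> diagram \<alpha>" "snd c = snd d" for c d
    using that pair[of c d] pair[of d c] by (intro less) (auto simp: doubleton_eq_iff)
  have PCT: "\<tau> \<in> PCT \<sigma> \<alpha>" using assms(2) by (simp add: SPCT_def)
  have c1: "(k, 1) \<in> diagram \<alpha>" if "1 \<le> k" "k \<le> length \<alpha>" for k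
    using that assms(1) by (auto simp: diagram_def composition_def Suc_le_eq)
  have fc: "first_column \<alpha> ?s = map ?t (first_column \<alpha> \<tau>)"
    using c1 by (auto simp: first_column_def swap_entries_apply)
  have fc_nth: "first_column \<alpha> \<rho> ! k = \<rho> (Suc k, 1)" if "k < length \<alpha>" for \<rho> k
    using that by (simp add: first_column_def nth_append del: upt_Suc)
  have "stan (first_column \<alpha> ?s) = stan (first_column \<alpha> \<tau>)"
  proof (rule stan_cong)
    fix k l assume "k < l" "l < length (first_column \<alpha> ?s)"
    then have "l < length \<alpha>" "k < length \<alpha>" by (auto simp: first_column_def simp del: upt_Suc)
    then show "first_column \<alpha> ?s ! l < first_column \<alpha> ?s ! k \<longleftrightarrow>
        first_column \<alpha> \<tau> ! l < first_column \<alpha> \<tau> ! k"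
      using c1[of "Suc k"] c1[of "Suc l"] same_col by (simp add: fc_nth)
  qed (simp add: first_column_def)
  moreover have "distinct (first_column \<alpha> ?s)"
    using PCT inj_on_subset[OF inj_transpose] by (auto simp: PCT_def fc distinct_map)
  moreover have "?s (k, j + 1) \<le> ?s (k, j)"
    if "(k, j) \<in> diagram \<alpha>" "(k, j + 1) \<in> diagram \<alpha>" for k j
  proof -
    have le: "\<tau> (k, j + 1) \<le> \<tau> (k, j)" using PCT that by (simp add: PCT_def)
    \<comment> \<open>Rows decrease, so the two entries could only occur with \<open>i + 1\<close>
      to the left of \<open>i\<close>, and then \<open>i\<close> would not be a descent.\<close>
    have "\<tau> (k, j) \<noteq> i + 1 \<or> \<tau> (k, j + 1) \<noteq> i"
      using pair[of "(k, j + 1)" "(k, j)"] that by auto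
    then have "{\<tau> (k, j), \<tau> (k, j + 1)} \<noteq> {i, i + 1}"
      using le by (auto simp: doubleton_eq_iff)
    then show ?thesis using less[of "(k, j)" "(k, j + 1)"] that le by auto
  qed
  moreover have "?s (r, j + 1) < ?s (k, j + 1)"
    if h: "k < r" "(k, j) \<in> diagram \<alpha>" "(k, j + 1) \<in> diagram \<alpha>" "(r, j + 1) \<in> diagram \<alpha>"
      "?s (r, j + 1) \<le> ?s (k, j)" for k r j
  proof -
    \<comment> \<open>With \<open>i\<close> in the left cell the two entries would attack; with
      \<open>i + 1\<close> there, \<open>i\<close> would not be a descent. Hence the premise of the
      triple condition carries over to \<open>\<tau>\<close>, and its conclusion returns by
      \<open>same_col\<close>.\<close>
    have "{\<tau> (k, j), \<tau> (r, j + 1)} \<noteq> {i, i + 1}"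
      using pair[of "(k, j)" "(r, j + 1)"] pair[of "(r, j + 1)" "(k, j)"] h
      by (auto simp: doubleton_eq_iff)
    then have "\<tau> (r, j + 1) \<le> \<tau> (k, j)"
      using less[of "(k, j)" "(r, j + 1)"] h by auto
    then have "\<tau> (r, j + 1) < \<tau> (k, j + 1)" using PCT h by (simp add: PCT_def)
    then show ?thesis using same_col h by simp
  qed
  moreover have "?s \<in> diagram \<alpha> \<rightarrow>\<^sub>E {1..}" "inj_on ?s (diagram \<alpha>)"
    "\<forall>c\<in>diagram \<alpha>. ?s c \<le> sum_list \<alpha>"
    using std' by (auto simp: standard_filling_def bij_betw_def PiE_def)
  ultimately show ?thesis using PCT by (simp add: SPCT_def PCT_def)
qed

lemma tableau_op_closed:
  assumes "composition n \<alpha>" "\<tau> \<in> SPCT \<sigma> \<alpha>"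
  shows "tableau_op \<alpha> i \<tau> \<in> basis_vec ` SPCT \<sigma> \<alpha> \<union> {0}"
  using swap_entries_in_SPCT[OF assms] assms(2) by (auto simp: tableau_op_def)

section \<open>The Hecke relations on basis vectors\<close>

lemmas pi_op_linear =
  linear_extension_add[of "tableau_op \<alpha> i" for \<alpha> i, folded pi_op_def]
  linear_extension_scale[of "tableau_op \<alpha> i" for \<alpha> i, folded pi_op_def]

lemma pi_op_basis_vec [simp]: "pi_op \<alpha> i (basis_vec \<tau>) = tableau_op \<alpha> i \<tau>"
  by (simp add: pi_op_def)

lemma pi_op_zero [simp]: "pi_op \<alpha> i 0 = 0"
  by (simp add: pi_op_def)

text \<open>After a swap, \<open>i + 1\<close> lies strictly left of \<open>i\<close>, so
  \<open>i\<close> has ceased to be a descent and the second application fixes the filling.\<close>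

lemma pi_op_idem_basis_vec:
  assumes "standard_filling \<alpha> \<tau>" "i \<in> {1..<sum_list \<alpha>}"
  shows "pi_op \<alpha> i (tableau_op \<alpha> i \<tau>) = tableau_op \<alpha> i \<tau>"
  using assms by (auto simp: tableau_op_def des_def attacking_def col_of_swap_entries)

text \<open>Both sides depend only on the cells of three entries. If the columns increase weakly
  from \<open>i\<close> to \<open>i + 2\<close>, both sides inspect the same three pairs of cells in
  opposite orders: an attacking pair gives 0 on both, otherwise \<open>swap_entries_braid\<close>
  applies. The remaining orders of the columns are settled by linear arithmetic.\<close>

lemma pi_op_braid_basis_vec:
  assumes "standard_filling \<alpha> \<tau>" "i \<in> {1..<sum_list \<alpha>}" "Suc i \<in> {1..<sum_list \<alpha>}"
  shows "pi_op \<alpha> i (pi_op \<alpha> (Suc i) (tableau_op \<alpha> i \<tau>)) =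
    pi_op \<alpha> (Suc i) (pi_op \<alpha> i (tableau_op \<alpha> (Suc i) \<tau>))"
  using assms
  by (simp add: tableau_op_def des_def attacking_def col_of_swap_entries row_of_swap_entries
      standard_filling_swap_entries swap_entries_braid; (intro impI conjI)?; simp?; linarith?)

text \<open>The pairs \<open>i, i + 1\<close> and \<open>j, j + 1\<close> are disjoint, so neither
  operator moves an entry that the other inspects.\<close>

lemma pi_op_commute_basis_vec:
  assumes "standard_filling \<alpha> \<tau>" "i \<in> {1..<sum_list \<alpha>}" "j \<in> {1..<sum_list \<alpha>}"
    and "\<bar>int i - int j\<bar> \<ge> 2"
  shows "pi_op \<alpha> i (tableau_op \<alpha> j \<tau>) = pi_op \<alpha> j (tableau_op \<alpha> i \<tau>)"
proof -
  have "i \<noteq> j" "i \<noteq> Suc j" "j \<noteq> Suc i" using assms(4) by auto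
  then show ?thesis
    using assms swap_entries_commute[OF assms(4)]
    by (auto simp: tableau_op_def des_def attacking_def col_of_swap_entries row_of_swap_entries)
qed

section \<open>The action of the 0-Hecke algebra\<close>

text \<open>With \<open>foldr\<close> the last letter acts first, so concatenation of words becomes
  composition of operators.\<close>

definition word_op :: "nat list \<Rightarrow> nat free_monoid \<Rightarrow> (filling \<Rightarrow>\<^sub>0 complex) \<Rightarrow> (filling \<Rightarrow>\<^sub>0 complex)" where
  "word_op \<alpha> u = foldr (pi_op \<alpha>) (letters u)"

definition free_op :: "nat list \<Rightarrow> free_elem \<Rightarrow> (filling \<Rightarrow>\<^sub>0 complex) \<Rightarrow> (filling \<Rightarrow>\<^sub>0 complex)" where
  "free_op \<alpha> p v = linear_extension (\<lambda>u. word_op \<alpha> u v) p"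

text \<open>The value of \<^const>\<open>free_op\<close> does not depend on the chosen representative of the class
  only for vectors in \<^const>\<open>SPCT_span\<close>.\<close>

definition hecke_op :: "nat list \<Rightarrow> free_elem set \<Rightarrow> (filling \<Rightarrow>\<^sub>0 complex) \<Rightarrow> (filling \<Rightarrow>\<^sub>0 complex)" where
  "hecke_op \<alpha> h = free_op \<alpha> (SOME p. p \<in> h)"

section \<open>Bilinearity of the action of the free algebra\<close>

lemma word_op_add: "word_op \<alpha> u (v + w) = word_op \<alpha> u v + word_op \<alpha> u w"
proof -
  have "foldr (pi_op \<alpha>) us (v + w) = foldr (pi_op \<alpha>) us v + foldr (pi_op \<alpha>) us w" for us
    by (induction us) (simp_all add: pi_op_linear)
  then show ?thesis by (simp add: word_op_def)
qed

lemma word_op_scale: "word_op \<alpha> u (cscale c v) = cscale c (word_op \<alpha> u v)"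
proof -
  have "foldr (pi_op \<alpha>) us (cscale c v) = cscale c (foldr (pi_op \<alpha>) us v)" for us
    by (induction us) (simp_all add: pi_op_linear)
  then show ?thesis by (simp add: word_op_def)
qed

lemma free_op_add_right: "free_op \<alpha> p (v + w) = free_op \<alpha> p v + free_op \<alpha> p w"
  by (simp add: free_op_def linear_extension_def word_op_add formal.scale_right_distrib sum.distrib)

lemma free_op_scale_right: "free_op \<alpha> p (cscale c v) = cscale c (free_op \<alpha> p v)"
  by (simp add: free_op_def linear_extension_def word_op_scale formal.scale_sum_right mult.commute)

lemma free_op_zero_right [simp]: "free_op \<alpha> p 0 = 0"
  using free_op_add_right[of \<alpha> p 0 0] by simp

lemma free_op_add: "free_op \<alpha> (p + q) v = free_op \<alpha> p v + free_op \<alpha> q v"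
  and free_op_diff: "free_op \<alpha> (p - q) v = free_op \<alpha> p v - free_op \<alpha> q v"
  and free_op_scale: "free_op \<alpha> (cscale c p) v = cscale c (free_op \<alpha> p v)"
  and free_op_zero [simp]: "free_op \<alpha> 0 v = 0"
  and free_op_basis_vec: "free_op \<alpha> (basis_vec u) v = word_op \<alpha> u v"
  by (simp_all add: free_op_def linear_extension_add linear_extension_diff linear_extension_scale)

lemma free_op_one [simp]: "free_op \<alpha> 1 v = v"
proof -
  \<comment> \<open>The unit of the free algebra is the basis vector of the empty word.\<close>
  have "free_op \<alpha> (basis_vec 0) v = v"
    unfolding free_op_basis_vec by (simp add: word_op_def zero_free_monoid_def)
  then show ?thesis by simp
qed

lemma free_op_gen: "free_op \<alpha> (free_gen i) v = pi_op \<alpha> i v"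
  by (simp add: free_gen_def free_op_basis_vec word_op_def)

section \<open>Scalars and products in the free algebra\<close>

lemma single_zero_mult: "Poly_Mapping.single 0 c * p = cscale c p" for p :: free_elem
  by (rule poly_mapping_eqI) (simp add: mult_map_scale_conv_mult[symmetric] cscale_def)

lemma cscale_mult: "cscale c p * q = cscale c (p * q)" for p q :: free_elem
  by (simp flip: single_zero_mult add: mult.assoc)

lemma cscale_basis_vec: "cscale c (basis_vec x) = Poly_Mapping.single x c"
  by (rule poly_mapping_eqI) (simp add: lookup_single when_def)

text \<open>The product is not commutative, so moving a scalar out of the right factor needs its own
  argument: bilinearity reduces it to a product of two words.\<close>

lemma mult_cscale: "p * cscale c q = cscale c (p * q)" for p q :: free_elem
proof (rule eq_on_span_basis_vec[of p UNIV])
  fix u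
  have "q \<in> formal.span (basis_vec ` UNIV)" by (simp add: in_span_basis_vec)
  then show "basis_vec u * cscale c q = cscale c (basis_vec u * q)"
  proof (induction rule: formal.span_induct_alt)
    case (step a x y)
    then obtain u' where x: "x = basis_vec u'" by auto
    \<comment> \<open>Stated for every \<open>b\<close>, since the outer scalar \<open>c\<close>
      merges with the coefficient \<open>a\<close>.\<close>
    have "basis_vec u * cscale b x = cscale b (basis_vec u * x)" for b
      by (simp add: x mult_single cscale_basis_vec)
    with step show ?case by (simp add: distrib_left formal.scale_right_distrib)
  qed simp
qed (auto simp: in_span_basis_vec distrib_right formal.scale_right_distrib cscale_mult mult.commute)

text \<open>Both sides are linear in \<open>p\<close> and in \<open>q\<close>; on two words the
  claim is that \<open>foldr\<close> turns appending into composition.\<close>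

lemma free_op_mult: "free_op \<alpha> (p * q) v = free_op \<alpha> p (free_op \<alpha> q v)"
proof (rule eq_on_span_basis_vec[of p UNIV])
  fix u
  show "free_op \<alpha> (basis_vec u * q) v = free_op \<alpha> (basis_vec u) (free_op \<alpha> q v)"
  proof (rule eq_on_span_basis_vec[of q UNIV])
    fix u'
    show "free_op \<alpha> (basis_vec u * basis_vec u') v =
      free_op \<alpha> (basis_vec u) (free_op \<alpha> (basis_vec u') v)"
      by (simp add: mult_single free_op_basis_vec word_op_def plus_free_monoid_def)
  qed (simp_all add: in_span_basis_vec distrib_left mult_cscale
      free_op_add free_op_scale free_op_add_right free_op_scale_right)
qed (simp_all add: in_span_basis_vec distrib_right cscale_mult free_op_add free_op_scale)

section \<open>Relations on the span of the tableaux\<close>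

context
  fixes n :: nat and \<alpha> :: "nat list" and \<sigma> :: "nat \<Rightarrow> nat"
  assumes comp: "composition n \<alpha>"
begin

lemma sum_list_composition: "sum_list \<alpha> = n"
  using comp by (simp add: composition_def)

lemma pi_op_closed:
  assumes "v \<in> SPCT_span \<sigma> \<alpha>"
  shows "pi_op \<alpha> i v \<in> SPCT_span \<sigma> \<alpha>"
  using assms unfolding SPCT_span_def
proof (induction rule: formal.span_induct_alt)
  case (step c x y)
  then obtain \<tau> where "\<tau> \<in> SPCT \<sigma> \<alpha>" "x = basis_vec \<tau>" by auto
  then have "pi_op \<alpha> i x \<in> formal.span (basis_vec ` SPCT \<sigma> \<alpha>)"
    using tableau_op_closed[OF comp, of \<tau> \<sigma> i] by (auto intro: formal.span_base formal.span_zero)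
  with step show ?case by (simp add: pi_op_linear formal.span_add formal.span_scale)
qed (simp add: formal.span_zero)

lemma pi_op_idem:
  assumes "v \<in> SPCT_span \<sigma> \<alpha>" "i \<in> {1..<n}"
  shows "pi_op \<alpha> i (pi_op \<alpha> i v) = pi_op \<alpha> i v"
  by (rule eq_on_span_basis_vec[OF assms(1)[unfolded SPCT_span_def]])
    (use assms(2) in \<open>simp_all add: pi_op_linear pi_op_idem_basis_vec standard_filling_if_SPCT
      sum_list_composition\<close>)

lemma pi_op_braid:
  assumes "v \<in> SPCT_span \<sigma> \<alpha>" "i \<in> {1..<n}" "Suc i \<in> {1..<n}"
  shows "pi_op \<alpha> i (pi_op \<alpha> (Suc i) (pi_op \<alpha> i v)) =
    pi_op \<alpha> (Suc i) (pi_op \<alpha> i (pi_op \<alpha> (Suc i) v))"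
  by (rule eq_on_span_basis_vec[OF assms(1)[unfolded SPCT_span_def]])
    (use assms(2,3) in \<open>simp_all add: pi_op_linear pi_op_braid_basis_vec standard_filling_if_SPCT
      sum_list_composition\<close>)

lemma pi_op_commute:
  assumes "v \<in> SPCT_span \<sigma> \<alpha>" "i \<in> {1..<n}" "j \<in> {1..<n}" "\<bar>int i - int j\<bar> \<ge> 2"
  shows "pi_op \<alpha> i (pi_op \<alpha> j v) = pi_op \<alpha> j (pi_op \<alpha> i v)"
proof (rule eq_on_span_basis_vec[OF assms(1)[unfolded SPCT_span_def]])
  fix \<tau> assume "\<tau> \<in> SPCT \<sigma> \<alpha>"
  then show "pi_op \<alpha> i (pi_op \<alpha> j (basis_vec \<tau>)) = pi_op \<alpha> j (pi_op \<alpha> i (basis_vec \<tau>))"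
    using assms pi_op_commute_basis_vec[of \<alpha> \<tau> i j]
    by (simp add: standard_filling_if_SPCT sum_list_composition)
qed (simp_all add: pi_op_linear)

lemma free_op_closed:
  assumes "v \<in> SPCT_span \<sigma> \<alpha>"
  shows "free_op \<alpha> p v \<in> SPCT_span \<sigma> \<alpha>"
proof -
  have "foldr (pi_op \<alpha>) us v \<in> SPCT_span \<sigma> \<alpha>" for us
    by (induction us) (use assms pi_op_closed in auto)
  then show ?thesis
    unfolding free_op_def linear_extension_def word_op_def SPCT_span_def
    by (auto intro: formal.span_sum formal.span_scale)
qed

section \<open>The annihilator of the span and the defining ideal\<close>

lemma free_gen_in_carrier: "i \<in> {1..<n} \<Longrightarrow> free_gen i \<in> carrier (free_algebra n)"
  by (simp add: free_algebra_def free_gen_def)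

text \<open>Left multiples annihilate because operators send 0 to 0; right multiples annihilate
  because the span is stable under the free algebra.\<close>

lemma ideal_annihilator:
  "ideal {p \<in> carrier (free_algebra n). \<forall>v\<in>SPCT_span \<sigma> \<alpha>. free_op \<alpha> p v = 0} (free_algebra n)"
  (is "ideal ?K ?R")
proof (rule idealI)
  interpret R: ring ?R by (rule ring_free_algebra)
  have ops: "a \<oplus>\<^bsub>?R\<^esub> b = a + b" "a \<otimes>\<^bsub>?R\<^esub> b = a * b" "\<zero>\<^bsub>?R\<^esub> = 0" for a b
    by (simp_all add: free_algebra_def)
  show "ring ?R" by (rule ring_free_algebra)
  show "subgroup ?K (add_monoid ?R)"
  proof (rule R.add.subgroupI)
    fix a assume a: "a \<in> ?K"
    \<comment> \<open>The additive inverse of the ring record is known only through its defining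
      equation, which determines its action.\<close>
    have "(\<ominus>\<^bsub>?R\<^esub> a) + a = 0" using a R.l_neg[of a] by (simp add: ops)
    then have "free_op \<alpha> (\<ominus>\<^bsub>?R\<^esub> a) v = - free_op \<alpha> a v" for v
      by (simp add: eq_neg_iff_add_eq_0 flip: free_op_add)
    with a R.a_inv_closed[of a] show "\<ominus>\<^bsub>?R\<^esub> a \<in> ?K" by simp
  next
    show "?K \<noteq> {}" using R.zero_closed ops(3) free_op_zero by fastforce
  next
    fix a b assume "a \<in> ?K" "b \<in> ?K"
    then show "a \<oplus>\<^bsub>?R\<^esub> b \<in> ?K" using R.a_closed[of a b] by (auto simp: ops free_op_add)
  qed auto
  fix a x assume "a \<in> ?K" "x \<in> carrier ?R"
  then show "x \<otimes>\<^bsub>?R\<^esub> a \<in> ?K" "a \<otimes>\<^bsub>?R\<^esub> x \<in> ?K"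
    using R.m_closed[of a x] R.m_closed[of x a] by (auto simp: ops free_op_mult free_op_closed)
qed

lemma hecke_relations_in_carrier: "hecke_relations n \<subseteq> carrier (free_algebra n)"
proof -
  interpret R: ring "free_algebra n" by (rule ring_free_algebra)
  have mult: "p * q \<in> carrier (free_algebra n)"
    if "p \<in> carrier (free_algebra n)" "q \<in> carrier (free_algebra n)" for p q
    using R.m_closed[OF that] by (simp add: free_algebra_def)
  \<comment> \<open>The relations use subtraction of formal combinations, not that of the ring
    record, so closure is read off the supports.\<close>
  have diff: "p - q \<in> carrier (free_algebra n)"
    if "p \<in> carrier (free_algebra n)" "q \<in> carrier (free_algebra n)" for p q
    using that keys_diff[of p q] by (fastforce simp: free_algebra_def)
  show ?thesis
    unfolding hecke_relations_def by (auto intro!: diff mult free_gen_in_carrier)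
qed

lemma free_op_hecke_ideal:
  assumes "p \<in> hecke_ideal n" "v \<in> SPCT_span \<sigma> \<alpha>"
  shows "free_op \<alpha> p v = 0"
proof -
  interpret R: ring "free_algebra n" by (rule ring_free_algebra)
  \<comment> \<open>The three families of relations become the idempotent, braid and commutation
    laws of the operators.\<close>
  have "free_op \<alpha> r w = 0" if "r \<in> hecke_relations n" "w \<in> SPCT_span \<sigma> \<alpha>" for r w
    using that unfolding hecke_relations_def
    by (auto simp: free_op_diff free_op_mult free_op_gen pi_op_idem pi_op_braid pi_op_commute)
  then have "hecke_ideal n \<subseteq>
      {p \<in> carrier (free_algebra n). \<forall>v\<in>SPCT_span \<sigma> \<alpha>. free_op \<alpha> p v = 0}"
    unfolding hecke_ideal_def using hecke_relations_in_carrier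
    by (intro R.genideal_minimal ideal_annihilator) auto
  with assms show ?thesis by auto
qed

section \<open>Descent to the quotient\<close>

lemma ideal_hecke_ideal: "ideal (hecke_ideal n) (free_algebra n)"
  unfolding hecke_ideal_def
  by (intro ring.genideal_ideal ring_free_algebra hecke_relations_in_carrier)

text \<open>The chosen representative differs from \<open>p\<close> by an element of the ideal,
  which annihilates the span.\<close>

lemma hecke_op_hecke_class:
  assumes "p \<in> carrier (free_algebra n)" "v \<in> SPCT_span \<sigma> \<alpha>"
  shows "hecke_op \<alpha> (hecke_class n p) v = free_op \<alpha> p v"
proof -
  interpret I: ideal "hecke_ideal n" "free_algebra n" by (rule ideal_hecke_ideal)
  let ?q = "SOME q. q \<in> hecke_class n p"
  have "p \<in> hecke_class n p"
    unfolding hecke_class_def using assms(1) by (rule I.a_rcos_self)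
  then have "?q \<in> hecke_class n p" by (rule someI)
  then obtain r where "r \<in> hecke_ideal n" "?q = r + p"
    by (auto simp: hecke_class_def a_r_coset_def' free_algebra_def)
  then show ?thesis
    using assms(2) by (simp add: hecke_op_def free_op_add free_op_hecke_ideal)
qed

lemma carrier_hecke_algebra: "carrier (hecke_algebra n) = hecke_class n ` carrier (free_algebra n)"
  by (auto simp: hecke_algebra_def hecke_class_def FactRing_def A_RCOSETS_def')

lemma hecke_action_hecke_op: "hecke_action n (SPCT_span \<sigma> \<alpha>) (hecke_op \<alpha>)"
proof -
  interpret I: ideal "hecke_ideal n" "free_algebra n" by (rule ideal_hecke_ideal)
  \<comment> \<open>Through the quotient homomorphism every axiom becomes a property of
    \<open>free_op\<close> on representatives.\<close>
  have hom: "hecke_class n \<in> ring_hom (free_algebra n) (hecke_algebra n)"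
    unfolding hecke_class_def[abs_def] hecke_algebra_def by (rule I.rcos_ring_hom)
  have scalar: "Poly_Mapping.single 0 c \<in> carrier (free_algebra n)" for c
    by (simp add: free_algebra_def zero_free_monoid_def)
  have subspace: "formal.subspace (SPCT_span \<sigma> \<alpha>)"
    by (simp add: SPCT_span_def)
  have add: "hecke_class n p \<oplus>\<^bsub>hecke_algebra n\<^esub> hecke_class n q = hecke_class n (p + q)"
    "p + q \<in> carrier (free_algebra n)"
    if "p \<in> carrier (free_algebra n)" "q \<in> carrier (free_algebra n)" for p q
    using ring_hom_add[OF hom that] I.a_closed[OF that] by (simp_all add: free_algebra_def)
  have mult: "hecke_class n p \<otimes>\<^bsub>hecke_algebra n\<^esub> hecke_class n q = hecke_class n (p * q)"
    "p * q \<in> carrier (free_algebra n)"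
    if "p \<in> carrier (free_algebra n)" "q \<in> carrier (free_algebra n)" for p q
    using ring_hom_mult[OF hom that] I.m_closed[OF that] by (simp_all add: free_algebra_def)
  have one: "\<one>\<^bsub>hecke_algebra n\<^esub> = hecke_class n 1" "1 \<in> carrier (free_algebra n)"
    using ring_hom_one[OF hom] I.one_closed by (simp_all add: free_algebra_def)
  show ?thesis
  proof
    show "formal.subspace (SPCT_span \<sigma> \<alpha>)" by (simp add: SPCT_span_def)
    show "hecke_op \<alpha> \<one>\<^bsub>hecke_algebra n\<^esub> v = v" if "v \<in> SPCT_span \<sigma> \<alpha>" for v
      using that by (simp only: one hecke_op_hecke_class free_op_one)
    fix h v c assume h: "h \<in> carrier (hecke_algebra n)" and v: "v \<in> SPCT_span \<sigma> \<alpha>"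
    then obtain p where p: "p \<in> carrier (free_algebra n)" "h = hecke_class n p"
      by (auto simp: carrier_hecke_algebra)
    show "hecke_op \<alpha> h v \<in> SPCT_span \<sigma> \<alpha>"
      using p v by (simp add: hecke_op_hecke_class free_op_closed)
    show "hecke_op \<alpha> h (cscale c v) = cscale c (hecke_op \<alpha> h v)"
      using p v by (simp add: hecke_op_hecke_class free_op_scale_right subspace
          formal.subspace_scale)
    \<comment> \<open>Scaling multiplies by the class of \<open>c\<close> times the empty word; on
      representatives this is \<open>cscale c p\<close> by \<open>single_zero_mult\<close>.\<close>
    show "hecke_op \<alpha> (hecke_scale n c h) v = cscale c (hecke_op \<alpha> h v)"
      unfolding hecke_scale_def p(2) mult(1)[OF scalar p(1)]
      using p v mult(2)[OF scalar p(1)]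
      by (simp add: hecke_op_hecke_class single_zero_mult free_op_scale)
    show "hecke_op \<alpha> h (v + w) = hecke_op \<alpha> h v + hecke_op \<alpha> h w"
      if "w \<in> SPCT_span \<sigma> \<alpha>" for w
      using p v that by (simp add: hecke_op_hecke_class free_op_add_right subspace
          formal.subspace_add)
    fix h' assume "h' \<in> carrier (hecke_algebra n)"
    then obtain q where q: "q \<in> carrier (free_algebra n)" "h' = hecke_class n q"
      by (auto simp: carrier_hecke_algebra)
    show "hecke_op \<alpha> (h \<oplus>\<^bsub>hecke_algebra n\<^esub> h') v = hecke_op \<alpha> h v + hecke_op \<alpha> h' v"
      using p q v by (simp add: add hecke_op_hecke_class free_op_add)
    show "hecke_op \<alpha> (h \<otimes>\<^bsub>hecke_algebra n\<^esub> h') v = hecke_op \<alpha> h (hecke_op \<alpha> h' v)"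
      using p q v by (simp add: mult hecke_op_hecke_class free_op_mult free_op_closed)
  qed
qed

end

theorem theorem3p1:
  fixes n :: nat and \<alpha> :: "nat list" and \<sigma> :: "nat \<Rightarrow> nat"
  assumes "composition n \<alpha>"
    and "\<sigma> permutes {1..length \<alpha>}"
  shows "(\<forall>i\<in>{1..<n}. \<forall>\<tau>\<in>SPCT \<sigma> \<alpha>. tableau_op \<alpha> i \<tau> \<in> basis_vec ` SPCT \<sigma> \<alpha> \<union> {0}) \<and>
    (\<forall>i\<in>{1..<n}. \<forall>v\<in>SPCT_span \<sigma> \<alpha>. pi_op \<alpha> i (pi_op \<alpha> i v) = pi_op \<alpha> i v) \<and>
    (\<forall>i. i \<in> {1..<n} \<and> i + 1 \<in> {1..<n} \<longrightarrow> (\<forall>v\<in>SPCT_span \<sigma> \<alpha>.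
       pi_op \<alpha> i (pi_op \<alpha> (i + 1) (pi_op \<alpha> i v)) =
       pi_op \<alpha> (i + 1) (pi_op \<alpha> i (pi_op \<alpha> (i + 1) v)))) \<and>
    (\<forall>i\<in>{1..<n}. \<forall>j\<in>{1..<n}. \<bar>int i - int j\<bar> \<ge> 2 \<longrightarrow> (\<forall>v\<in>SPCT_span \<sigma> \<alpha>.
       pi_op \<alpha> i (pi_op \<alpha> j v) = pi_op \<alpha> j (pi_op \<alpha> i v))) \<and>
    (\<exists>act. hecke_action n (SPCT_span \<sigma> \<alpha>) act \<and>
       (\<forall>i\<in>{1..<n}. \<forall>v\<in>SPCT_span \<sigma> \<alpha>. act (hecke_gen n i) v = pi_op \<alpha> i v))"
proof (intro conjI allI ballI impI)
  show "\<exists>act. hecke_action n (SPCT_span \<sigma> \<alpha>) act \<and>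
       (\<forall>i\<in>{1..<n}. \<forall>v\<in>SPCT_span \<sigma> \<alpha>. act (hecke_gen n i) v = pi_op \<alpha> i v)"
  proof (intro exI conjI ballI)
    show "hecke_action n (SPCT_span \<sigma> \<alpha>) (hecke_op \<alpha>)"
      by (rule hecke_action_hecke_op[OF assms(1)])
    \<comment> \<open>A generator is the class of a one-letter word, which acts by a single
      operator.\<close>
    show "hecke_op \<alpha> (hecke_gen n i) v = pi_op \<alpha> i v"
      if "i \<in> {1..<n}" "v \<in> SPCT_span \<sigma> \<alpha>" for i v
      using that hecke_op_hecke_class[OF assms(1) free_gen_in_carrier[OF assms(1)]]
      by (simp add: hecke_gen_def free_op_gen)
  qed
next
  fix i \<tau> assume "\<tau> \<in> SPCT \<sigma> \<alpha>"
  then show "tableau_op \<alpha> i \<tau> \<in> basis_vec ` SPCT \<sigma> \<alpha> \<union> {0}"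
    by (rule tableau_op_closed[OF assms(1)])
next
  fix i v assume "i \<in> {1..<n}" "v \<in> SPCT_span \<sigma> \<alpha>"
  then show "pi_op \<alpha> i (pi_op \<alpha> i v) = pi_op \<alpha> i v" by (intro pi_op_idem[OF assms(1)])
next
  fix i v assume "i \<in> {1..<n} \<and> i + 1 \<in> {1..<n}" "v \<in> SPCT_span \<sigma> \<alpha>"
  then show "pi_op \<alpha> i (pi_op \<alpha> (i + 1) (pi_op \<alpha> i v)) =
      pi_op \<alpha> (i + 1) (pi_op \<alpha> i (pi_op \<alpha> (i + 1) v))"
    using pi_op_braid[OF assms(1), of v \<sigma> i] by simp
next
  fix i j v
  assume "i \<in> {1..<n}" "j \<in> {1..<n}" "2 \<le> \<bar>int i - int j\<bar>" "v \<in> SPCT_span \<sigma> \<alpha>"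
  then show "pi_op \<alpha> i (pi_op \<alpha> j v) = pi_op \<alpha> j (pi_op \<alpha> i v)"
    by (intro pi_op_commute[OF assms(1)])
qed

end
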